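(* Let $k \ge 7$ be an odd integer and let $\chi$ be a nonprincipal, real, primitive, odd Dirichlet character modulo $k$. Then \[ \sum_{ j=1 }^{ k-1 } \chi(j) \sin^2 \left( \frac{ \pi j }{ k } \right) \cot \left( \frac{ \pi j }{ k } \right) = \frac 1 2 \sqrt k \, . \]
   Context: A Dirichlet character modulo $k$ is a nonzero completely multiplicative $k$-periodic function $\chi:\mathbb{Z}\to\mathbb{C}$ with $\chi(n)=0$ whenever $\gcd(n,k)>1$; it is real if it takes only real values, odd if $\chi(-n)=-\chi(n)$, and primitive if it is not induced by a character modulo a proper divisor of $k$. *)

theory Defs
  imports Complex_Main
begin

definition dirichlet_character :: "nat \<Rightarrow> (int \<Rightarrow> complex) \<Rightarrow> bool" where
  "dirichlet_character k \<chi> \<longleftrightarrow>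
     k > 0 \<and>
     (\<exists>n. \<chi> n \<noteq> 0) \<and>
     (\<forall>m n. \<chi> (m * n) = \<chi> m * \<chi> n) \<and>
     (\<forall>n. \<chi> (n + int k) = \<chi> n) \<and>
     (\<forall>n. gcd n (int k) > 1 \<longrightarrow> \<chi> n = 0)"

definition principal_character :: "nat \<Rightarrow> int \<Rightarrow> complex" where
  "principal_character k n = (if coprime n (int k) then 1 else 0)"

definition real_character :: "(int \<Rightarrow> complex) \<Rightarrow> bool" where
  "real_character \<chi> \<longleftrightarrow> (\<forall>n. \<chi> n \<in> \<real>)"

definition odd_character :: "(int \<Rightarrow> complex) \<Rightarrow> bool" where
  "odd_character \<chi> \<longleftrightarrow> (\<forall>n. \<chi> (- n) = - \<chi> n)"

text \<open>
  The character modulo \<open>k\<close> induced by a character \<open>\<psi>\<close> modulo a divisor of \<open>k\<close> is the product of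
  \<open>\<psi>\<close> with the principal character modulo \<open>k\<close>.
\<close>

definition induced_character :: "nat \<Rightarrow> (int \<Rightarrow> complex) \<Rightarrow> int \<Rightarrow> complex" where
  "induced_character k \<psi> n = \<psi> n * principal_character k n"

definition primitive_character :: "nat \<Rightarrow> (int \<Rightarrow> complex) \<Rightarrow> bool" where
  "primitive_character k \<chi> \<longleftrightarrow>
     dirichlet_character k \<chi> \<and>
     \<not> (\<exists>d \<psi>. d dvd k \<and> d \<noteq> k \<and> dirichlet_character d \<psi> \<and> \<chi> = induced_character k \<psi>)"

end

theory Submission
  imports Defs "HOL-Analysis.Convex" "HOL-Number_Theory.Number_Theory"
    "HOL-Computational_Algebra.Squarefree"
begin

text \<open>
  Since \<open>sin\<^sup>2 x cot x = sin (2 x) / 2\<close>, the sum is half the imaginary part of the Gauss sum of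
  \<open>\<chi>\<close>. A real primitive character modulo an odd \<open>k\<close> is a product of Legendre symbols over the
  primes dividing the squarefree number \<open>k\<close>; hence the quadratic sums
  \<open>Q(a) = \<Sum>n mod k. exp (2 \<pi> i a n\<^sup>2 / k)\<close> satisfy \<open>Q(a) = \<chi>(a) Q(1)\<close>, and evaluating
  \<open>\<Sum>a. \<chi>(a) Q(a)\<close> in two ways identifies the Gauss sum of \<open>\<chi>\<close> with \<open>Q(1)\<close>. Oddness makes
  \<open>Q(1)\<close> purely imaginary and forces \<open>k \<equiv> 3\<close> modulo \<open>4\<close>, and \<open>\<bar>Q(1)\<bar>\<^sup>2 = k\<close>. The sign follows from
  the crude estimate \<open>Im Q(1) > - sqrt k\<close>, obtained by partial summation.
\<close>

subsection \<open>Exponential sums over complete residue systems\<close>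

text \<open>Reduction modulo \<open>k\<close> is injective on an index set of the right size, hence
  a bijection onto \<open>{0..<int k}\<close>. The index type is left open so that affine maps,
  pairs of residues and symmetric intervals can all be used.\<close>

lemma sum_complete_residues:
  fixes g :: "'i \<Rightarrow> int" and f :: "int \<Rightarrow> 'b::comm_monoid_add"
  assumes "k > 0" and "card I = k"
    and inj: "\<And>i j. i \<in> I \<Longrightarrow> j \<in> I \<Longrightarrow> [g i = g j] (mod int k) \<Longrightarrow> i = j"
    and cong: "\<And>x y. [x = y] (mod int k) \<Longrightarrow> f x = f y"
  shows "(\<Sum>i\<in>I. f (g i)) = (\<Sum>n\<in>{0..<int k}. f n)"
proof -
  let ?h = "\<lambda>i. g i mod int k"
  have inj_h: "inj_on ?h I"
    using inj by (auto simp: inj_on_def cong_def)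
  moreover have "?h ` I \<subseteq> {0..<int k}"
    using \<open>k > 0\<close> by auto
  moreover have "card (?h ` I) = card {0..<int k}"
    using inj_h \<open>card I = k\<close> by (simp add: card_image)
  ultimately have image: "?h ` I = {0..<int k}"
    by (intro card_subset_eq) auto
  have "(\<Sum>i\<in>I. f (g i)) = (\<Sum>i\<in>I. f (?h i))"
    by (intro sum.cong refl cong) (simp add: cong_def)
  also have "\<dots> = (\<Sum>n\<in>?h ` I. f n)"
    using inj_h by (simp add: sum.reindex)
  finally show ?thesis
    by (simp add: image)
qed

lemma sum_residues_affine:
  fixes f :: "int \<Rightarrow> 'b::comm_monoid_add"
  assumes "k > 0" and "coprime u (int k)"
    and cong: "\<And>x y. [x = y] (mod int k) \<Longrightarrow> f x = f y"
  shows "(\<Sum>n\<in>{0..<int k}. f (u * n + v)) = (\<Sum>n\<in>{0..<int k}. f n)"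
proof (rule sum_complete_residues)
  fix i j assume "i \<in> {0..<int k}" "j \<in> {0..<int k}" "[u * i + v = u * j + v] (mod int k)"
  moreover from this have "[i = j] (mod int k)"
    using \<open>coprime u (int k)\<close> by (simp add: cong_add_rcancel cong_mult_lcancel)
  ultimately show "i = j"
    by (simp add: cong_def)
qed (use assms in auto)

section \<open>Roots of unity and their orthogonality\<close>

definition unit_root :: "nat \<Rightarrow> int \<Rightarrow> complex" where
  "unit_root k n = cis (2 * pi * of_int n / of_nat k)"

lemma unit_root_0 [simp]: "unit_root k 0 = 1"
  by (simp add: unit_root_def)

lemma unit_root_add: "unit_root k (m + n) = unit_root k m * unit_root k n"
  by (simp add: unit_root_def cis_mult ring_distribs add_divide_distrib)

lemma cnj_unit_root: "cnj (unit_root k n) = unit_root k (- n)"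
  by (simp add: unit_root_def cis_cnj)

lemma unit_root_cancel: "m > 0 \<Longrightarrow> unit_root (p * m) (int m * a) = unit_root p a"
  by (simp add: unit_root_def mult.assoc)

lemma unit_root_eq_1_iff:
  assumes "k > 0"
  shows "unit_root k n = 1 \<longleftrightarrow> int k dvd n"
proof
  assume "unit_root k n = 1"
  then have "cos (2 * pi * of_int n / of_nat k) = 1"
    by (metis cis.sel(1) one_complex.sel(1) unit_root_def)
  then obtain m :: int where "2 * pi * of_int n / of_nat k = of_int m * 2 * pi"
    by (auto simp: cos_one_2pi_int)
  then have "real_of_int n = real_of_int (m * int k)"
    using \<open>k > 0\<close> by (simp add: field_simps)
  then show "int k dvd n"
    using of_int_eq_iff by (metis dvd_triv_right)
next
  assume "int k dvd n"
  then obtain m where "n = int k * m" ..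
  then have "2 * pi * of_int n / of_nat k = 2 * pi * real_of_int m"
    using \<open>k > 0\<close> by simp
  then show "unit_root k n = 1"
    unfolding unit_root_def by (simp del: times_divide_eq_right)
qed

lemma unit_root_cong:
  assumes "k > 0" and "[m = n] (mod int k)"
  shows "unit_root k m = unit_root k n"
proof -
  have "unit_root k (m - n) = 1"
    using assms by (simp add: unit_root_eq_1_iff cong_iff_dvd_diff)
  then show ?thesis
    using unit_root_add[of k "m - n" n] by simp
qed

lemma sum_unit_root_cong:
  "k > 0 \<Longrightarrow> [x = y] (mod int k) \<Longrightarrow> unit_root k (a * x) = unit_root k (a * y)"
  by (intro unit_root_cong cong_mult) auto

text \<open>Shifting \<open>n\<close> by one multiplies the sum by \<open>unit_root k a\<close>,
  which differs from 1 unless \<open>k\<close> divides \<open>a\<close>.\<close>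

lemma sum_unit_root:
  assumes "k > 0"
  shows "(\<Sum>n\<in>{0..<int k}. unit_root k (a * n)) = (if int k dvd a then of_nat k else 0)"
proof (cases "int k dvd a")
  case True
  then have "unit_root k (a * n) = 1" for n
    using assms by (simp add: unit_root_eq_1_iff)
  with True show ?thesis
    by simp
next
  case False
  let ?S = "\<Sum>n\<in>{0..<int k}. unit_root k (a * n)"
  have "?S = (\<Sum>n\<in>{0..<int k}. unit_root k (a * (1 * n + 1)))"
    using assms by (intro sum_residues_affine[symmetric] sum_unit_root_cong) auto
  also have "\<dots> = unit_root k a * ?S"
    by (simp add: ring_distribs unit_root_add sum_distrib_left mult.commute)
  finally have "(unit_root k a - 1) * ?S = 0"
    by (simp add: algebra_simps)
  with False show ?thesis
    using assms by (simp add: unit_root_eq_1_iff)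
qed

subsection \<open>Quadratic Gauss sums\<close>

definition gauss_sum :: "nat \<Rightarrow> int \<Rightarrow> complex" where
  "gauss_sum k a = (\<Sum>n\<in>{0..<int k}. unit_root k (a * n\<^sup>2))"

lemma unit_root_square_cong:
  "k > 0 \<Longrightarrow> [x = y] (mod int k) \<Longrightarrow> unit_root k (a * x\<^sup>2) = unit_root k (a * y\<^sup>2)"
  by (intro sum_unit_root_cong cong_pow)

lemma gauss_sum_cong:
  "k > 0 \<Longrightarrow> [a = b] (mod int k) \<Longrightarrow> gauss_sum k a = gauss_sum k b"
  unfolding gauss_sum_def by (intro sum.cong refl unit_root_cong cong_mult) auto

lemma gauss_sum_mult_square:
  assumes "k > 0" and "coprime u (int k)"
  shows "gauss_sum k (u\<^sup>2 * a) = gauss_sum k a"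
proof -
  have "gauss_sum k (u\<^sup>2 * a) = (\<Sum>n\<in>{0..<int k}. unit_root k (a * (u * n + 0)\<^sup>2))"
    by (simp add: gauss_sum_def power_mult_distrib algebra_simps)
  also have "\<dots> = gauss_sum k a"
    unfolding gauss_sum_def using assms by (intro sum_residues_affine unit_root_square_cong)
  finally show ?thesis .
qed

lemma cnj_gauss_sum: "cnj (gauss_sum k a) = gauss_sum k (- a)"
  by (simp add: gauss_sum_def cnj_unit_root)

lemma norm_gauss_sum:
  assumes "odd k"
  shows "(norm (gauss_sum k 1))\<^sup>2 = real k"
proof -
  have k: "k > 0"
    using assms by (rule odd_pos)
  let ?R = "{0..<int k}"
  have dvd_iff: "int k dvd 2 * h \<longleftrightarrow> h = 0" if "h \<in> ?R" for h
    using that assms coprime_dvd_mult_right_iff[of "int k" 2 h] by (auto dest: zdvd_imp_le)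
  have "gauss_sum k 1 * cnj (gauss_sum k 1) = (\<Sum>y\<in>?R. \<Sum>x\<in>?R. unit_root k (x\<^sup>2 - y\<^sup>2))"
    by (subst sum.swap)
       (simp add: gauss_sum_def cnj_unit_root sum_product unit_root_add flip: diff_conv_add_uminus unit_root_add)
  \<comment> \<open>With \<open>x = h + y\<close> the phase becomes linear in \<open>y\<close>, so
    orthogonality leaves only \<open>2 * h\<close> divisible by \<open>k\<close>, that is
    \<open>h = 0\<close>.\<close>
  also have "\<dots> = (\<Sum>y\<in>?R. \<Sum>h\<in>?R. unit_root k ((1 * h + y)\<^sup>2 - y\<^sup>2))"
    using k by (intro sum.cong refl sum_residues_affine[symmetric] unit_root_cong cong_diff cong_pow) auto
  also have "\<dots> = (\<Sum>h\<in>?R. \<Sum>y\<in>?R. unit_root k (h\<^sup>2) * unit_root k (2 * h * y))"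
    by (subst sum.swap) (simp add: power2_eq_square algebra_simps flip: unit_root_add)
  also have "\<dots> = (\<Sum>h\<in>?R. unit_root k (h\<^sup>2) * (if h = 0 then of_nat k else 0))"
    using k dvd_iff by (intro sum.cong refl) (simp add: sum_unit_root flip: sum_distrib_left)
  also have "\<dots> = of_nat k"
    using k by (simp add: if_distrib cong: if_cong)
  finally have "complex_of_real ((norm (gauss_sum k 1))\<^sup>2) = complex_of_real (real k)"
    unfolding complex_norm_square by simp
  then show ?thesis
    by (simp only: of_real_eq_iff)
qed

text \<open>By the Chinese remainder theorem \<open>m * x + p * y\<close> runs through the residues
  modulo \<open>p * m\<close>. In its square the cross term vanishes modulo \<open>p * m\<close>,
  and each remaining square keeps one spare factor \<open>m\<close> or \<open>p\<close>.\<close>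

lemma gauss_sum_mult:
  assumes "p > 0" and "m > 0" and "coprime p m"
  shows "gauss_sum (p * m) a = gauss_sum p (a * int m) * gauss_sum m (a * int p)"
proof -
  let ?I = "{0..<int p} \<times> {0..<int m}"
  let ?g = "\<lambda>(x, y). int m * x + int p * y"
  have "gauss_sum (p * m) a = (\<Sum>z\<in>?I. unit_root (p * m) (a * (?g z)\<^sup>2))"
    unfolding gauss_sum_def
  proof (rule sum_complete_residues[symmetric])
    fix z w assume *: "z \<in> ?I" "w \<in> ?I" "[?g z = ?g w] (mod int (p * m))"
    obtain x y x' y' where zw: "z = (x, y)" "w = (x', y')"
      by fastforce
    have "[int m * x + int p * y = int m * x' + int p * y'] (mod int p)"
      and "[int m * x + int p * y = int m * x' + int p * y'] (mod int m)"
      using * cong_modulus_mult[of _ _ "int p" "int m"] cong_modulus_mult[of _ _ "int m" "int p"]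
      by (simp_all add: zw mult.commute)
    then have "[int m * x = int m * x'] (mod int p)" "[int p * y = int p * y'] (mod int m)"
      by (simp_all add: cong_def)
    moreover have "coprime (int m) (int p)" "coprime (int p) (int m)"
      using assms by (simp_all add: coprime_commute)
    ultimately have "[x = x'] (mod int p)" "[y = y'] (mod int m)"
      by (simp_all only: cong_mult_lcancel)
    with * show "z = w"
      by (auto simp: zw cong_def)
  qed (use assms in \<open>auto simp: card_cartesian_product intro: unit_root_square_cong\<close>)
  also have "\<dots> = (\<Sum>z\<in>?I. unit_root p (a * int m * (fst z)\<^sup>2) * unit_root m (a * int p * (snd z)\<^sup>2))"
  proof (intro sum.cong refl)
    fix z assume "z \<in> ?I"
    obtain x y where z: "z = (x, y)"
      by fastforce
    have "unit_root (p * m) (a * (?g z)\<^sup>2) =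
        unit_root (p * m) (int m * (a * int m * x\<^sup>2) + int p * (a * int p * y\<^sup>2))"
      using assms
      by (intro unit_root_cong) (auto simp: z cong_iff_dvd_diff power2_eq_square algebra_simps)
    also have "\<dots> = unit_root p (a * int m * x\<^sup>2) * unit_root m (a * int p * y\<^sup>2)"
      using assms unit_root_cancel[of m p "a * int m * x\<^sup>2"] unit_root_cancel[of p m "a * int p * y\<^sup>2"]
      by (simp add: unit_root_add mult.commute[of m p])
    finally show "unit_root (p * m) (a * (?g z)\<^sup>2) =
        unit_root p (a * int m * (fst z)\<^sup>2) * unit_root m (a * int p * (snd z)\<^sup>2)"
      by (simp add: z)
  qed
  also have "\<dots> = gauss_sum p (a * int m) * gauss_sum m (a * int p)"
    by (simp add: gauss_sum_def sum_product sum.cartesian_product case_prod_unfold)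
  finally show ?thesis .
qed

section \<open>Symmetric residues and prime modulus\<close>

lemma sum_symmetric_interval:
  fixes f :: "int \<Rightarrow> 'b::comm_monoid_add"
  shows "(\<Sum>n\<in>{- int h..int h}. f n) = f 0 + ((\<Sum>n\<in>{1..int h}. f (- n)) + (\<Sum>n\<in>{1..int h}. f n))"
proof -
  have split: "{- int h..int h} = insert 0 (uminus ` {1..int h} \<union> {1..int h})"
    by auto
  have "(\<Sum>n\<in>{- int h..int h}. f n) = f 0 + (\<Sum>n\<in>uminus ` {1..int h} \<union> {1..int h}. f n)"
    unfolding split by (rule sum.insert) auto
  also have "(\<Sum>n\<in>uminus ` {1..int h} \<union> {1..int h}. f n) =
      (\<Sum>n\<in>uminus ` {1..int h}. f n) + (\<Sum>n\<in>{1..int h}. f n)"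
    by (rule sum.union_disjoint) auto
  also have "(\<Sum>n\<in>uminus ` {1..int h}. f n) = (\<Sum>n\<in>{1..int h}. f (- n))"
    by (subst sum.reindex) auto
  finally show ?thesis .
qed

lemma gauss_sum_half:
  assumes "k = 2 * h + 1"
  shows "gauss_sum k a = 1 + 2 * (\<Sum>n\<in>{1..int h}. unit_root k (a * n\<^sup>2))"
proof -
  let ?f = "\<lambda>n. unit_root k (a * n\<^sup>2)"
  have "gauss_sum k a = (\<Sum>n\<in>{- int h..int h}. ?f n)"
    unfolding gauss_sum_def
  proof (rule sum_complete_residues[symmetric])
    fix i j assume "i \<in> {- int h..int h}" "j \<in> {- int h..int h}" "[i = j] (mod int k)"
    moreover from this have "\<bar>i - j\<bar> < int k"
      using assms by auto
    ultimately show "i = j"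
      using zdvd_imp_le[of "int k" "\<bar>i - j\<bar>"] by (auto simp: cong_iff_dvd_diff)
  qed (use assms in \<open>auto intro: unit_root_square_cong\<close>)
  also have "\<dots> = 1 + 2 * (\<Sum>n\<in>{1..int h}. ?f n)"
    by (subst sum_symmetric_interval) simp
  finally show ?thesis .
qed

text \<open>The prime divides \<open>x - y\<close> or \<open>x + y\<close>, and both are smaller
  than \<open>p\<close> in absolute value. Hence the squares of the lower half of the residues are
  distinct.\<close>

lemma prime_dvd_diff_squaresD:
  fixes p x y :: int
  assumes "prime p" and "[x\<^sup>2 = y\<^sup>2] (mod p)" and "0 \<le> x" "0 \<le> y" "x + y < p"
  shows "x = y"
proof -
  have "p dvd (x - y) * (x + y)"
    using assms(2) by (simp add: cong_iff_dvd_diff power2_eq_square algebra_simps)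
  then consider "p dvd \<bar>x - y\<bar>" | "p dvd x + y"
    using \<open>prime p\<close> by (auto simp: prime_dvd_mult_iff)
  then show ?thesis
    using zdvd_imp_le[of p "\<bar>x - y\<bar>"] zdvd_imp_le[of p "x + y"] assms(3-5)
    by cases (smt (verit))+
qed

text \<open>For a residue \<open>u\<close>, a square root of \<open>u\<close> is absorbed into the
  summation variable. For a nonresidue, the squares and \<open>u\<close> times the squares together
  exhaust all residues, so the two Gauss sums add up to twice a vanishing complete sum.\<close>

lemma gauss_sum_prime:
  assumes p: "prime p" "odd p" and u: "\<not> int p dvd u" and a: "\<not> int p dvd a"
  shows "gauss_sum p (u * a) = of_int (Legendre u (int p)) * gauss_sum p a"
proof (cases "QuadRes (int p) u")
  case True
  then obtain y where y: "[y\<^sup>2 = u] (mod int p)"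
    by (auto simp: QuadRes_def)
  then have "\<not> int p dvd y"
    using u by (auto simp: cong_dvd_iff power2_eq_square dest: cong_dvd_iff)
  then have "coprime y (int p)"
    using p by (metis coprime_commute prime_imp_coprime prime_nat_int_transfer)
  then have "gauss_sum p (y\<^sup>2 * a) = gauss_sum p a"
    using p by (intro gauss_sum_mult_square prime_gt_0_nat)
  moreover have "gauss_sum p (u * a) = gauss_sum p (y\<^sup>2 * a)"
    using p y by (intro gauss_sum_cong cong_mult) (auto simp: prime_gt_0_nat cong_sym)
  ultimately show ?thesis
    using True u by (simp add: Legendre_def cong_0_iff)
next
  case False
  have p0: "p > 0"
    using p by (simp add: prime_gt_0_nat)
  have pr: "prime (int p)"
    using p by simp
  obtain h where h: "p = 2 * h + 1"
    using p(2) oddE by blast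
  \<comment> \<open>Nonnegative indices yield 0 and the quadratic residues, negative ones the
    nonresidues: \<open>2 * h + 1 = p\<close> values, with 0 taken once.\<close>
  let ?g = "\<lambda>n. if n \<ge> 0 then n\<^sup>2 else u * n\<^sup>2"
  let ?f = "\<lambda>n. unit_root p (a * n)"
  \<comment> \<open>Dividing such a coincidence by \<open>j\<^sup>2\<close> would exhibit
    \<open>u\<close> as a square modulo \<open>p\<close>.\<close>
  have mixed: False if "0 \<le> i" "j < 0" "- int h \<le> j" "[i\<^sup>2 = u * j\<^sup>2] (mod int p)" for i j
  proof -
    have "\<not> int p dvd j"
      using that h zdvd_imp_le[of "int p" "- j"] by auto
    then have "coprime j (int p)"
      using pr by (metis coprime_commute prime_imp_coprime)
    then obtain v where "[j * v = 1] (mod int p)"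
      using cong_solve_coprime_int by blast
    then have "[u * (j * v)\<^sup>2 = u * 1\<^sup>2] (mod int p)"
      by (intro cong_mult cong_pow) auto
    moreover have "[i\<^sup>2 * v\<^sup>2 = (u * j\<^sup>2) * v\<^sup>2] (mod int p)"
      using that by (intro cong_mult) auto
    ultimately have "[(i * v)\<^sup>2 = u] (mod int p)"
      by (metis (no_types, lifting) cong_trans mult.assoc mult.right_neutral one_power2 power_mult_distrib)
    then show False
      using False by (auto simp: QuadRes_def)
  qed
  have "(\<Sum>n\<in>{- int h..int h}. ?f (?g n)) = (\<Sum>n\<in>{0..<int p}. ?f n)"
  proof (rule sum_complete_residues)
    fix i j assume *: "i \<in> {- int h..int h}" "j \<in> {- int h..int h}" "[?g i = ?g j] (mod int p)"
    consider "i \<ge> 0" "j \<ge> 0" | "i \<ge> 0" "j < 0" | "i < 0" "j \<ge> 0" | "i < 0" "j < 0"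
      by linarith
    then show "i = j"
    proof cases
      case 1
      then show ?thesis
        using * h by (intro prime_dvd_diff_squaresD[OF pr]) auto
    next
      case 2
      then show ?thesis
        using * mixed[of i j] by auto
    next
      case 3
      then show ?thesis
        using * mixed[of j i] by (auto simp: cong_sym_eq)
    next
      case 4
      have "coprime u (int p)"
        using u pr by (metis coprime_commute prime_imp_coprime)
      then have "[(- i)\<^sup>2 = (- j)\<^sup>2] (mod int p)"
        using * 4 by (simp add: cong_mult_lcancel)
      then have "- i = - j"
        using 4 * h by (intro prime_dvd_diff_squaresD[OF pr]) auto
      then show ?thesis
        by simp
    qed
  qed (use h p0 in \<open>auto intro: sum_unit_root_cong\<close>)
  then have "(\<Sum>n\<in>{- int h..int h}. ?f (?g n)) = 0"
    using sum_unit_root[OF p0, of a] a by simp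
  then have zero: "1 + ((\<Sum>n\<in>{1..int h}. ?f (?g (- n))) + (\<Sum>n\<in>{1..int h}. ?f (?g n))) = 0"
    by (subst (asm) sum_symmetric_interval) simp
  have neg: "(\<Sum>n\<in>{1..int h}. ?f (?g (- n))) = (\<Sum>n\<in>{1..int h}. unit_root p (u * a * n\<^sup>2))"
    by (intro sum.cong) (auto simp: algebra_simps)
  have pos: "(\<Sum>n\<in>{1..int h}. ?f (?g n)) = (\<Sum>n\<in>{1..int h}. unit_root p (a * n\<^sup>2))"
    by (intro sum.cong) auto
  have "gauss_sum p (u * a) + gauss_sum p a =
      2 * (1 + ((\<Sum>n\<in>{1..int h}. unit_root p (u * a * n\<^sup>2)) + (\<Sum>n\<in>{1..int h}. unit_root p (a * n\<^sup>2))))"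
    unfolding gauss_sum_half[OF h] by simp
  with zero have "gauss_sum p (u * a) + gauss_sum p a = 0"
    unfolding neg pos by (simp only: mult_zero_right)
  then show ?thesis
    using False u by (simp add: Legendre_def cong_0_iff add_eq_0_iff2)
qed

lemma Legendre_minus_one:
  assumes "prime p" "odd p"
  shows "Legendre (- 1) (int p) = (if p mod 4 = 1 then 1 else - 1)"
proof -
  have p2: "p > 2"
    using assms by (metis dvd_refl le_neq_implies_less prime_ge_2_nat)
  have "[Legendre (- 1) (int p) = (- 1) ^ ((p - 1) div 2)] (mod int p)"
    using euler_criterion[OF assms(1) p2, of "- 1"] by simp
  moreover have "(- 1 :: int) ^ ((p - 1) div 2) = (if p mod 4 = 1 then 1 else - 1)"
  proof -
    have "even ((p - 1) div 2) \<longleftrightarrow> p mod 4 = 1"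
      using assms(2) by presburger
    then show ?thesis
      by (simp add: uminus_power_if)
  qed
  moreover have "Legendre (- 1) (int p) \<in> {1, - 1}"
    using p2 by (auto simp: Legendre_def cong_0_iff dest: zdvd_imp_le)
  \<comment> \<open>The values 1 and -1 are distinct modulo \<open>p\<close>, so Euler's congruence
    becomes an equality.\<close>
  moreover have "\<not> int p dvd 2"
    using p2 by (auto dest: zdvd_imp_le)
  ultimately show ?thesis
    by (auto simp: cong_iff_dvd_diff split: if_splits)
qed

subsection \<open>Real primitive characters\<close>

text \<open>Lifts units modulo \<open>d\<close> to units modulo \<open>k\<close>. With
  \<open>t\<close> the product of the primes of \<open>k\<close> that do not divide
  \<open>n\<close>, each prime of \<open>k\<close> divides exactly one of \<open>n\<close> and
  \<open>d * t\<close>, hence not their sum.\<close>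

lemma exists_coprime_cong:
  fixes n d k :: int
  assumes "k > 0" and "coprime n d"
  shows "\<exists>n'. [n' = n] (mod d) \<and> coprime n' k"
proof -
  define t where "t = \<Prod>{p \<in> prime_factors k. \<not> p dvd n}"
  have "coprime (n + d * t) k"
  proof (rule ccontr)
    assume "\<not> coprime (n + d * t) k"
    then obtain c where c: "c dvd n + d * t" "c dvd k" "\<not> is_unit c"
      by (rule not_coprimeE)
    moreover from this obtain p where "prime p" "p dvd c"
      using \<open>k > 0\<close> by (metis dvd_0_left_iff less_irrefl prime_divisor_exists)
    ultimately have p: "prime p" "p dvd n + d * t" "p dvd k"
      by (auto intro: dvd_trans)
    have pk: "p \<in> prime_factors k"
      using p assms by (simp add: in_prime_factors_iff)
    show False
    proof (cases "p dvd n")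
      case True
      then have "p dvd d * t"
        using p(2) by (simp add: dvd_add_right_iff)
      moreover have "\<not> p dvd d"
        using True p(1) \<open>coprime n d\<close> not_coprimeI by (metis not_prime_unit)
      ultimately have "p dvd t"
        using p(1) by (simp add: prime_dvd_mult_iff)
      then obtain q where q: "q \<in> prime_factors k" "\<not> q dvd n" "p dvd q"
        unfolding t_def using p(1) by (auto simp: prime_dvd_prod_iff)
      then have "p = q"
        using p(1) by (auto simp: in_prime_factors_iff primes_dvd_imp_eq)
      with q True show ?thesis
        by simp
    next
      case False
      then have "p dvd t"
        unfolding t_def using pk by (intro dvd_prodI) auto
      then have "p dvd n"
        using p(2) by (simp add: dvd_add_left_iff)
      with False show ?thesis ..
    qed
  qed
  then show ?thesis
    by (intro exI[of _ "n + d * t"]) (simp add: cong_def)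
qed

section \<open>General properties of Dirichlet characters\<close>

context
  fixes k :: nat and \<chi> :: "int \<Rightarrow> complex"
  assumes character: "dirichlet_character k \<chi>"
begin

lemma modulus_pos: "k > 0"
  and character_mult: "\<chi> (m * n) = \<chi> m * \<chi> n"
  and character_not_coprime: "\<not> coprime n (int k) \<Longrightarrow> \<chi> n = 0"
proof -
  have "gcd n (int k) > 1" if "\<not> coprime n (int k)"
  proof -
    have "gcd n (int k) \<noteq> 1" "gcd n (int k) \<ge> 0"  "gcd n (int k) \<noteq> 0"
      using that character by (auto simp: coprime_iff_gcd_eq_1 dirichlet_character_def)
    then show ?thesis
      by linarith
  qed
  then show "k > 0" "\<chi> (m * n) = \<chi> m * \<chi> n" "\<not> coprime n (int k) \<Longrightarrow> \<chi> n = 0"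
    using character by (auto simp: dirichlet_character_def)
qed

lemma character_cong:
  assumes "[m = n] (mod int k)"
  shows "\<chi> m = \<chi> n"
proof -
  have shift: "\<chi> (n + int k * int j) = \<chi> n" for n j
  proof (induction j)
    case (Suc j)
    have "\<chi> (n + int k * int j + int k) = \<chi> (n + int k * int j)"
      using character by (simp add: dirichlet_character_def)
    with Suc show ?case
      by (simp add: algebra_simps)
  qed simp
  have "\<chi> m = \<chi> (m mod int k)" for m
  proof (cases "m div int k \<ge> 0")
    case True
    then show ?thesis
      using shift[of "m mod int k" "nat (m div int k)"] by simp
  next
    case False
    \<comment> \<open>\<open>shift\<close> only adds natural multiples of \<open>k\<close>, so for a
      negative quotient it starts from \<open>m\<close> and ends at the residue.\<close>
    then have "m + int k * int (nat (- (m div int k))) = m mod int k"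
      using div_mult_mod_eq[of m "int k"] by (simp add: algebra_simps)
    then show ?thesis
      using shift[of m "nat (- (m div int k))"] by simp
  qed
  then show ?thesis
    using assms by (metis cong_def)
qed

lemma character_1: "\<chi> 1 = 1"
proof -
  obtain n where "\<chi> n \<noteq> 0"
    using character by (auto simp: dirichlet_character_def)
  then show ?thesis
    using character_mult[of n 1] by simp
qed

lemma character_power: "\<chi> (n ^ m) = \<chi> n ^ m"
  by (induction m) (simp_all add: character_1 character_mult)

lemma character_nonzero:
  assumes "coprime n (int k)"
  shows "\<chi> n \<noteq> 0"
proof -
  obtain v where "[n * v = 1] (mod int k)"
    using assms cong_solve_coprime_int by blast
  then have "\<chi> n * \<chi> v = 1"
    using character_cong by (metis character_1 character_mult)
  then show ?thesis
    by auto
qed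

text \<open>A character that is trivial on the kernel of reduction from units modulo
  \<open>k\<close> to units modulo \<open>d\<close> factors through the latter group.\<close>

lemma induced_character_if_trivial:
  assumes "d dvd k"
    and trivial: "\<And>u. [u = 1] (mod int d) \<Longrightarrow> coprime u (int k) \<Longrightarrow> \<chi> u = 1"
  shows "\<exists>\<psi>. dirichlet_character d \<psi> \<and> \<chi> = induced_character k \<psi>"
proof -
  have dk: "int d dvd int k" and d: "d > 0"
    using assms modulus_pos by (auto intro: dvd_pos_nat)
  have eq: "\<chi> m = \<chi> n"
    if mn: "coprime m (int k)" "coprime n (int k)" "[m = n] (mod int d)" for m n
  proof -
    obtain v where v: "[n * v = 1] (mod int k)"
      using mn(2) cong_solve_coprime_int by blast
    then have nv: "coprime (n * v) (int k)"
      using cong_imp_coprime[OF cong_sym] by fastforce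
    then have mv: "coprime (m * v) (int k)"
      using mn(1) by simp
    have "[m * v = n * v] (mod int d)"
      using mn(3) by (intro cong_mult) auto
    moreover have "[n * v = 1] (mod int d)"
      using v dk by (rule cong_dvd_modulus)
    ultimately have "[m * v = 1] (mod int d)"
      by (rule cong_trans)
    then have "\<chi> (m * v) = 1"
      using mv by (rule trivial)
    also have "1 = \<chi> (n * v)"
      using character_cong[OF v] character_1 by simp
    finally have "\<chi> m * \<chi> v = \<chi> n * \<chi> v"
      by (simp add: character_mult)
    moreover have "\<chi> v \<noteq> 0"
      using nv by (intro character_nonzero) simp
    ultimately show ?thesis
      by simp
  qed
  \<comment> \<open>An arbitrary choice of lift suffices, since \<open>eq\<close> makes the value of
    \<open>\<chi>\<close> independent of it.\<close>
  define lift where "lift n = (SOME n'. [n' = n] (mod int d) \<and> coprime n' (int k))" for n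
  define \<psi> where "\<psi> n = (if coprime n (int d) then \<chi> (lift n) else 0)" for n
  have lift: "[lift n = n] (mod int d)" "coprime (lift n) (int k)" if "coprime n (int d)" for n
    using someI_ex[OF exists_coprime_cong[of "int k" n "int d"]] that modulus_pos
    unfolding lift_def by auto
  have \<psi>_eq: "\<psi> n = \<chi> m" if "coprime m (int k)" "[m = n] (mod int d)" for m n
  proof -
    have "coprime m (int d)"
      using that(1) dk by (auto intro: coprime_divisors[OF dvd_refl])
    then have n: "coprime n (int d)"
      using that(2) cong_imp_coprime by blast
    have "\<chi> (lift n) = \<chi> m"
      using lift(2)[OF n] that(1) cong_trans[OF lift(1)[OF n] cong_sym[OF that(2)]] by (rule eq)
    with n show ?thesis
      by (simp add: \<psi>_def)
  qed
  have "\<psi> (m * n) = \<psi> m * \<psi> n" for m n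
  proof (cases "coprime m (int d) \<and> coprime n (int d)")
    case True
    then have "\<psi> (m * n) = \<chi> (lift m * lift n)"
      by (intro \<psi>_eq) (auto intro: lift cong_mult)
    with True show ?thesis
      by (simp add: \<psi>_def character_mult)
  next
    case False
    then show ?thesis
      by (auto simp: \<psi>_def)
  qed
  moreover have "\<psi> (n + int d) = \<psi> n" for n
  proof (cases "coprime n (int d)")
    case True
    then have "\<psi> (n + int d) = \<chi> (lift n)"
      using lift[OF True] by (intro \<psi>_eq) (auto simp: cong_def)
    with True show ?thesis
      by (simp add: \<psi>_def)
  next
    case False
    then show ?thesis
      by (simp add: \<psi>_def coprime_iff_gcd_eq_1 gcd_add1)
  qed
  moreover have "\<psi> 1 \<noteq> 0"
    using \<psi>_eq[of 1 1] by (simp add: character_1)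
  ultimately have "dirichlet_character d \<psi>"
    using d by (auto simp: dirichlet_character_def \<psi>_def)
  moreover have "\<chi> n = induced_character k \<psi> n" for n
    using \<psi>_eq[of n n] character_not_coprime[of n]
    by (auto simp: induced_character_def principal_character_def)
  ultimately show ?thesis
    by blast
qed

text \<open>Euler's theorem makes the value a root of unity, and a real number of norm 1 is a
  sign.\<close>

lemma real_character_sign:
  assumes "real_character \<chi>" and "coprime n (int k)"
  shows "\<chi> n = 1 \<or> \<chi> n = - 1"
proof -
  have "\<chi> n \<in> \<real>"
    using assms(1) by (simp add: real_character_def)
  then obtain x where x: "\<chi> n = of_real x"
    by (rule Reals_cases)
  define m where "m = nat (n mod int k)"
  have m: "int m = n mod int k"
    using modulus_pos by (simp add: m_def)
  then have "coprime (int m) (int k)"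
    using assms(2) modulus_pos by (simp add: m)
  then have "[m ^ totient k = 1] (mod k)"
    by (intro euler_theorem) simp
  then have "[int (m ^ totient k) = int 1] (mod int k)"
    by (simp only: cong_int_iff)
  then have "[(n mod int k) ^ totient k = 1] (mod int k)"
    by (simp add: m)
  then have "[n ^ totient k = 1] (mod int k)"
    by (simp only: cong_def power_mod)
  then have "\<chi> (n ^ totient k) = \<chi> 1"
    by (rule character_cong)
  then have "\<chi> n ^ totient k = 1"
    by (simp only: character_1 character_power)
  then have "norm (\<chi> n ^ totient k) = 1"
    by (simp only: norm_one)
  then have "norm (\<chi> n) ^ totient k = 1 ^ totient k"
    by (simp only: norm_power power_one)
  then have "norm (\<chi> n) = 1"
    by (rule power_eq_imp_eq_base) (simp_all add: modulus_pos)
  then have "x = 1 \<or> x = - 1"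
    unfolding x norm_of_real by linarith
  then show ?thesis
    unfolding x by auto
qed

lemma real_character_square:
  assumes "real_character \<chi>" and "coprime n (int k)"
  shows "\<chi> n * \<chi> n = 1"
  using real_character_sign[OF assms] by auto

end

section \<open>Consequences of primitivity\<close>

lemma dirichlet_character_if_primitive:
  "primitive_character k \<chi> \<Longrightarrow> dirichlet_character k \<chi>"
  by (simp add: primitive_character_def)

text \<open>Contrapositive of the factorization criterion, and the form in which primitivity enters
  the arguments below.\<close>

lemma primitive_character_nontrivial:
  assumes "primitive_character k \<chi>" and "d dvd k" and "d \<noteq> k"
  obtains u where "[u = 1] (mod int d)" and "coprime u (int k)" and "\<chi> u \<noteq> 1"
proof (rule ccontr)
  assume "\<not> thesis"
  with that have "\<And>u. [u = 1] (mod int d) \<Longrightarrow> coprime u (int k) \<Longrightarrow> \<chi> u = 1"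
    by blast
  then have "\<exists>\<psi>. dirichlet_character d \<psi> \<and> \<chi> = induced_character k \<psi>"
    by (rule induced_character_if_trivial[OF dirichlet_character_if_primitive[OF assms(1)] assms(2)])
  with assms show False
    unfolding primitive_character_def by blast
qed

text \<open>For a unit \<open>b\<close>, substitute \<open>b * n\<close> and use that
  \<open>\<chi> b\<close> is a sign. Otherwise some unit \<open>u\<close> with
  \<open>\<chi> u \<noteq> 1\<close> satisfies \<open>b * u = b\<close> modulo \<open>k\<close>; the
  substitution \<open>u * n\<close> then reproduces the sum with the factor \<open>\<chi> u\<close>,
  so it vanishes.\<close>

lemma character_sum_twisted:
  assumes prim: "primitive_character k \<chi>" and real: "real_character \<chi>"
  shows "(\<Sum>n\<in>{0..<int k}. \<chi> n * unit_root k (b * n)) =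
    \<chi> b * (\<Sum>n\<in>{0..<int k}. \<chi> n * unit_root k n)"
proof -
  note char = dirichlet_character_if_primitive[OF prim]
  have k: "k > 0"
    using modulus_pos[OF char] .
  let ?G = "\<lambda>b. \<Sum>n\<in>{0..<int k}. \<chi> n * unit_root k (b * n)"
  have twist: "\<chi> u * ?G (b * u) = ?G b" if u: "coprime u (int k)" for b u
  proof -
    have "?G b = (\<Sum>n\<in>{0..<int k}. \<chi> (u * n + 0) * unit_root k (b * (u * n + 0)))"
      using k u by (intro sum_residues_affine[symmetric] arg_cong2[of _ _ _ _ "(*)"]
          character_cong[OF char] sum_unit_root_cong)
    then show ?thesis
      by (simp add: character_mult[OF char] sum_distrib_left mult.assoc)
  qed
  show ?thesis
  proof (cases "coprime b (int k)")
    case True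
    then have "\<chi> b * (\<chi> b * ?G (1 * b)) = \<chi> b * ?G 1"
      using twist[of b 1] by simp
    then show ?thesis
      using real_character_square[OF char real True] by (simp flip: mult.assoc)
  next
    case False
    define g where "g = nat (gcd b (int k))"
    have g: "int g = gcd b (int k)"
      by (simp add: g_def)
    then have "int g dvd int k"
      by simp
    then obtain d where d: "k = g * d"
      by (auto elim: dvdE)
    have "g \<noteq> 1"
      using False g by (auto simp: coprime_iff_gcd_eq_1)
    then have "d dvd k" "d \<noteq> k"
      using d k by auto
    with prim obtain u where u: "[u = 1] (mod int d)" "coprime u (int k)" "\<chi> u \<noteq> 1"
      by (rule primitive_character_nontrivial)
    have "int g dvd b"
      by (simp add: g)
    moreover have "int d dvd u - 1"
      using u by (simp add: cong_iff_dvd_diff)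
    ultimately have "int g * int d dvd b * (u - 1)"
      by (rule mult_dvd_mono)
    then have "[b * u = b] (mod int k)"
      by (simp add: d cong_iff_dvd_diff right_diff_distrib)
    then have "?G (b * u) = ?G b"
      using k by (intro sum.cong refl arg_cong2[of _ _ _ _ "(*)"] unit_root_cong cong_mult) auto
    with twist[OF u(2), of b] u(3) have "?G b = 0"
      by (metis mult_cancel_right1)
    then show ?thesis
      using False character_not_coprime[OF char] by simp
  qed
qed

text \<open>If \<open>p\<^sup>2\<close> divides \<open>k\<close>, every unit that is 1 modulo
  \<open>k / p\<close> has \<open>p\<close>-th power 1 modulo \<open>k\<close>. As \<open>p\<close>
  is odd, a character with values 1 and -1 is trivial on these units, against primitivity. Only
  \<open>p \<noteq> 1\<close> is assumed, not primality.\<close>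

lemma real_primitive_squarefree:
  assumes prim: "primitive_character k \<chi>" and real: "real_character \<chi>" and "odd k"
  shows "squarefree k"
proof (rule ccontr)
  note char = dirichlet_character_if_primitive[OF prim]
  assume "\<not> squarefree k"
  then obtain p where p: "\<not> p dvd 1" "p\<^sup>2 dvd k"
    by (auto simp: squarefree_def)
  then obtain m where "k = p\<^sup>2 * m"
    by (auto elim: dvdE)
  then have m: "k = p * (p * m)"
    by (simp add: power2_eq_square)
  have "p * m dvd k" "p * m \<noteq> k"
    using m p(1) modulus_pos[OF char] by auto
  with prim obtain u where u: "[u = 1] (mod int (p * m))" "coprime u (int k)" "\<chi> u \<noteq> 1"
    by (rule primitive_character_nontrivial)
  have dvd: "int (p * m) dvd u - 1"
    using u(1) by (simp add: cong_iff_dvd_diff)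
  then have "[u = 1] (mod int p)"
    unfolding cong_iff_dvd_diff by (rule dvd_trans[rotated]) simp
  \<comment> \<open>This is the cofactor of \<open>u - 1\<close> in \<open>u ^ p - 1\<close>; its
    \<open>p\<close> terms are all 1 modulo \<open>p\<close>, which supplies the missing factor
    \<open>p\<close>.\<close>
  then have "[(\<Sum>i<p. u ^ i) = (\<Sum>i<p. 1 ^ i)] (mod int p)"
    by (intro cong_sum cong_pow)
  then have "int p dvd (\<Sum>i<p. u ^ i)"
    by (simp add: cong_dvd_iff)
  with dvd have "int (p * m) * int p dvd (u - 1) * (\<Sum>i<p. u ^ i)"
    by (rule mult_dvd_mono)
  then have "[u ^ p = 1] (mod int k)"
    by (simp add: m cong_iff_dvd_diff power_diff_1_eq mult_ac)
  then have "\<chi> u ^ p = 1"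
    using character_cong[OF char] character_power[OF char, of u p] character_1[OF char] by metis
  moreover have "odd p"
    using m \<open>odd k\<close> by auto
  ultimately show False
    using real_character_sign[OF char real u(2)] u(3) by auto
qed

text \<open>
  Every unit that is \<open>1\<close> modulo \<open>m\<close> and a square modulo \<open>p\<close> is a square modulo \<open>p * m\<close>, so
  the character is trivial on it; primitivity forces the value \<open>- 1\<close> on the others.
\<close>

lemma real_primitive_eq_Legendre:
  assumes prim: "primitive_character (p * m) \<chi>" and real: "real_character \<chi>"
    and p: "prime p" and cop: "coprime p m"
    and u: "[u = 1] (mod int m)" "coprime u (int (p * m))"
  shows "\<chi> u = of_int (Legendre u (int p))"
proof -
  note char = dirichlet_character_if_primitive[OF prim]
  have square: "\<chi> v = 1"
    if v: "[v = 1] (mod int m)" "coprime v (int (p * m))" and "QuadRes (int p) v" for v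
  proof -
    obtain y where y: "[y\<^sup>2 = v] (mod int p)"
      using \<open>QuadRes (int p) v\<close> by (auto simp: QuadRes_def)
    obtain w where w: "[w = y] (mod int p)" "[w = 1] (mod int m)"
      using binary_chinese_remainder_int[of "int p" "int m" y 1] cop by auto
    have "[w\<^sup>2 = v] (mod int p)"
      using cong_pow[OF w(1)] y by (rule cong_trans)
    moreover have "[w\<^sup>2 = v] (mod int m)"
      using cong_pow[OF w(2), of 2] v(1) by (metis cong_sym cong_trans one_power2)
    ultimately have w2: "[w\<^sup>2 = v] (mod int (p * m))"
      using cop by (simp add: coprime_cong_mult)
    then have "coprime (w\<^sup>2) (int (p * m))"
      using v(2) cong_imp_coprime cong_sym by blast
    then have "\<chi> w * \<chi> w = 1"
      by (intro real_character_square[OF char real]) simp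
    then show ?thesis
      using character_cong[OF char w2] by (simp add: power2_eq_square character_mult[OF char])
  qed
  have "m dvd p * m" "m \<noteq> p * m"
    using p modulus_pos[OF char] by auto
  with prim obtain u0 where u0: "[u0 = 1] (mod int m)" "coprime u0 (int (p * m))" "\<chi> u0 \<noteq> 1"
    by (rule primitive_character_nontrivial)
  have unit: "\<not> int p dvd v" if "coprime v (int (p * m))" for v
    using that p by (auto simp: coprime_commute dest: coprime_common_divisor)
  show ?thesis
  proof (cases "QuadRes (int p) u")
    case True
    then show ?thesis
      using square u unit by (simp add: Legendre_def cong_0_iff)
  next
    case False
    have L: "Legendre v (int p) = - 1" if "\<not> QuadRes (int p) v" "coprime v (int (p * m))" for v
      using that unit by (simp add: Legendre_def cong_0_iff)
    have p2: "odd p"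
    proof
      assume "even p"
      then have "p = 2"
        using p by (metis primes_dvd_imp_eq two_is_prime_nat)
      then have "[1\<^sup>2 = u] (mod int p)"
        using unit[OF u(2)] by (simp add: cong_iff_dvd_diff)
      with False show False
        unfolding QuadRes_def by blast
    qed
    have nr: "\<not> QuadRes (int p) u0"
      using square u0 by blast
    have "p > 2"
      using p p2 by (metis dvd_refl le_neq_implies_less prime_ge_2_nat)
    \<comment> \<open>By Euler's criterion two nonresidues multiply to a residue, so
      \<open>square\<close> applies to \<open>u * u0\<close> and \<open>\<chi> u\<close> must equal
      \<open>\<chi> u0\<close>, which is -1.\<close>
    have "QuadRes (int p) (u * u0)"
    proof -
      have E: "[Legendre v (int p) = v ^ ((p - 1) div 2)] (mod int p)" for v
        using euler_criterion[OF p \<open>p > 2\<close>] .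
      have "[u ^ ((p - 1) div 2) * u0 ^ ((p - 1) div 2) = (- 1) * (- 1)] (mod int p)"
        using E[of u] E[of u0] L[OF False u(2)] L[OF nr u0(2)]
        by (intro cong_mult) (simp_all add: cong_sym)
      then have "[Legendre (u * u0) (int p) = 1] (mod int p)"
        using E[of "u * u0"] by (metis cong_trans mult_minus1 minus_minus power_mult_distrib)
      then show ?thesis
        using \<open>p > 2\<close> zdvd_imp_le[of "int p" 2] zdvd_imp_le[of "int p" 1]
        by (auto simp: Legendre_def cong_iff_dvd_diff split: if_splits)
    qed
    then have "\<chi> (u * u0) = 1"
      using u u0 by (intro square) (auto intro: cong_mult[of _ 1 _ _ 1, simplified])
    then have "\<chi> u = - 1"
      using real_character_sign[OF char real u(2)] real_character_sign[OF char real u0(2)] u0(3)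
      by (auto simp: character_mult[OF char])
    then show ?thesis
      using L[OF False u(2)] by simp
  qed
qed

section \<open>Quadratic Gauss sums against the character\<close>

lemma squarefree_mult_imp_coprime:
  fixes a b :: "'a::algebraic_semidom"
  shows "squarefree (a * b) \<Longrightarrow> coprime a b"
  by (rule coprimeI) (metis mult_dvd_mono power2_eq_square squarefreeD)

text \<open>A unit that is 1 away from a single prime \<open>p\<close> changes only the
  \<open>p\<close>-factor of the Gauss sum, by a Legendre symbol that equals its character value
  (\<open>local\<close>). A general unit is a product of such units, one for each prime of
  \<open>k\<close>.\<close>

lemma gauss_sum_eq_character_mult:
  assumes prim: "primitive_character k \<chi>" and real: "real_character \<chi>" and "odd k"
    and a: "coprime a (int k)"
  shows "gauss_sum k a = \<chi> a * gauss_sum k 1"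
proof -
  note char = dirichlet_character_if_primitive[OF prim]
  have k: "k > 0"
    using modulus_pos[OF char] .
  have sqf: "squarefree k"
    using prim real \<open>odd k\<close> by (rule real_primitive_squarefree)
  have local: "gauss_sum k (u * b) = \<chi> u * gauss_sum k b"
    if pm: "k = p * m" and p: "prime p" and u: "[u = 1] (mod int m)" "coprime u (int k)"
      and b: "coprime b (int k)" for p m u b
  proof -
    have cop: "coprime p m"
      using sqf pm squarefree_mult_imp_coprime by blast
    have pos: "p > 0" "m > 0"
      using pm k by auto
    have "odd p"
      using pm \<open>odd k\<close> by simp
    have nd: "\<not> int p dvd v" if "coprime v (int p)" for v
      using that p by (auto simp: coprime_commute dest: coprime_common_divisor)
    have cu: "coprime u (int p)" and cb: "coprime (b * int m) (int p)"
      using u b pm cop by (auto simp: coprime_commute)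
    have "gauss_sum p (u * b * int m) = of_int (Legendre u (int p)) * gauss_sum p (b * int m)"
      using gauss_sum_prime[OF p \<open>odd p\<close> nd[OF cu] nd[OF cb]] by (simp add: mult.assoc)
    moreover have "gauss_sum m (u * b * int p) = gauss_sum m (1 * b * int p)"
      using pos u by (intro gauss_sum_cong cong_mult) auto
    moreover have "\<chi> u = of_int (Legendre u (int p))"
      using prim real p cop u unfolding pm by (intro real_primitive_eq_Legendre)
    ultimately show ?thesis
      unfolding pm by (simp add: gauss_sum_mult[OF pos cop])
  qed
  \<comment> \<open>Here \<open>d\<close> holds the primes at which \<open>a\<close> may still
    differ from 1. The induction is on \<open>d\<close>, and the claim is the case
    \<open>d = k\<close>, \<open>m = 1\<close>.\<close>
  have "gauss_sum k (a * b) = \<chi> a * gauss_sum k b"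
    if "k = d * m" "[a = 1] (mod int m)" "coprime a (int k)" "coprime b (int k)" for d m a b
    using that
  proof (induction d arbitrary: m a b rule: prime_divisors_induct)
    case zero
    then show ?case
      using k by simp
  next
    case (unit d)
    then have "[a = 1] (mod int k)"
      by simp
    then have "gauss_sum k (a * b) = gauss_sum k (1 * b)" "\<chi> a = \<chi> 1"
      using gauss_sum_cong[OF k cong_mult[OF _ cong_refl]] character_cong[OF char] by blast+
    then show ?case
      by (simp add: character_1[OF char])
  next
    case (factor p d)
    have km: "k = p * (d * m)" "k = d * (p * m)"
      using factor.prems by simp_all
    have cop: "coprime p (d * m)" 
      using sqf km(1) squarefree_mult_imp_coprime by blast
    \<comment> \<open>\<open>u\<close> carries the \<open>p\<close>-part of \<open>a\<close>.
      Multiplying \<open>a\<close> by the inverse \<open>v\<close> of \<open>u\<close> removes that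
      part, so the induction hypothesis applies to \<open>a * v\<close> with \<open>p * m\<close> in
      place of \<open>m\<close>.\<close>
    obtain u where u: "[u = a] (mod int p)" "[u = 1] (mod int (d * m))"
      using binary_chinese_remainder_int[of "int p" "int (d * m)" a 1] cop by auto
    have "coprime a (int p)"
      using factor.prems(3) unfolding km(1) by simp
    then have "coprime u (int p)"
      using cong_imp_coprime[OF cong_sym[OF u(1)]] by simp
    moreover have "coprime u (int (d * m))"
      using cong_imp_coprime[OF cong_sym[OF u(2)]] by simp
    ultimately have cu: "coprime u (int k)"
      unfolding km(1) by simp
    then obtain v where v: "[u * v = 1] (mod int k)"
      using cong_solve_coprime_int by blast
    then have "coprime (u * v) (int k)"
      using cong_imp_coprime[OF cong_sym[OF v]] by simp
    then have cv: "coprime v (int k)"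
      by simp
    let ?a = "a * v"
    have ua: "[u * ?a = a] (mod int k)"
      using cong_mult[OF cong_refl v, of a] by (simp add: mult_ac)
    have "[?a = 1] (mod int p)"
    proof -
      have "[a * v = u * v] (mod int p)"
        using u by (intro cong_mult) (auto simp: cong_sym)
      moreover have "[u * v = 1] (mod int p)"
        using v by (rule cong_dvd_modulus) (simp add: km(1))
      ultimately show ?thesis
        by (rule cong_trans)
    qed
    moreover have "[?a = 1] (mod int m)"
    proof -
      have "[u = 1] (mod int m)"
        using u(2) by (rule cong_dvd_modulus) simp
      then have "[a * v = u * v] (mod int m)"
        using cong_trans[OF factor.prems(2) cong_sym] by (intro cong_mult) auto
      moreover have "[u * v = 1] (mod int m)"
        using v by (rule cong_dvd_modulus) (simp add: km(2))
      ultimately show ?thesis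
        by (rule cong_trans)
    qed
    ultimately have a1: "[?a = 1] (mod int (p * m))"
      using cop by (simp add: coprime_cong_mult)
    have ca: "coprime ?a (int k)"
      using cv factor.prems by simp
    have "gauss_sum k (a * b) = gauss_sum k (u * (?a * b))"
      using gauss_sum_cong[OF k cong_mult[OF cong_sym[OF ua] cong_refl]] by (simp only: mult.assoc)
    also have "\<dots> = \<chi> u * gauss_sum k (?a * b)"
      using local[OF km(1) _ u(2) cu, of "?a * b"] factor.hyps ca factor.prems(4) by simp
    also have "\<dots> = \<chi> u * (\<chi> ?a * gauss_sum k b)"
      using factor.IH[OF km(2) a1 ca factor.prems(4)] by (rule arg_cong)
    also have "\<dots> = \<chi> (u * ?a) * gauss_sum k b"
      by (simp only: character_mult[OF char] mult.assoc)
    also have "\<dots> = \<chi> a * gauss_sum k b"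
      by (simp only: character_cong[OF char ua])
    finally show ?case .
  qed
  from this[of k 1 a 1] a show ?thesis
    by simp
qed

text \<open>Each prime contributes its Legendre symbol of -1, and these signs multiply as the
  classes modulo 4 do. \<open>a\<close> varies in the induction because splitting off
  \<open>p\<close> replaces it by \<open>a * int p\<close>.\<close>

lemma gauss_sum_minus:
  assumes "squarefree k" and "odd k" and "coprime a (int k)"
  shows "gauss_sum k (- a) = (if k mod 4 = 1 then 1 else - 1) * gauss_sum k a"
  using assms
proof (induction k arbitrary: a rule: prime_divisors_induct)
  case zero
  then show ?case
    by simp
next
  case (unit k)
  moreover have "{0..<1::int} = {0}"
    by auto
  ultimately show ?case
    by (simp add: gauss_sum_def)
next
  case (factor p k)
  have cop: "coprime p k" and sqf: "squarefree k"
    using factor.prems(1) squarefree_mult_imp_coprime squarefree_multD by blast+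
  have "odd p" "odd k" and pos: "p > 0" "k > 0"
    using factor.prems(2) by (auto intro: odd_pos)
  have ck: "coprime (a * int p) (int k)" and cp: "coprime (a * int k) (int p)"
    using factor.prems(3) cop by (auto simp: coprime_commute)
  have nd: "\<not> int p dvd v" if "coprime v (int p)" for v
    using that factor.hyps by (auto simp: coprime_commute dest: coprime_common_divisor)
  have "\<not> int p dvd a * int k" "\<not> int p dvd - 1"
    using cp by (intro nd; simp)+
  then have "gauss_sum p (- (a * int k)) = (if p mod 4 = 1 then 1 else - 1) * gauss_sum p (a * int k)"
    using gauss_sum_prime[of p "- 1" "a * int k"] Legendre_minus_one[of p] factor.hyps \<open>odd p\<close> by simp
  moreover have "gauss_sum k (- (a * int p)) = (if k mod 4 = 1 then 1 else - 1) * gauss_sum k (a * int p)"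
    using sqf \<open>odd k\<close> ck by (rule factor.IH)
  moreover have "p * k mod 4 = 1 \<longleftrightarrow> (p mod 4 = 1 \<longleftrightarrow> k mod 4 = 1)"
  proof -
    have "p mod 4 = 1 \<or> p mod 4 = 3" "k mod 4 = 1 \<or> k mod 4 = 3"
      using \<open>odd p\<close> \<open>odd k\<close> by presburger+
    then show ?thesis
      by (subst mod_mult_eq[symmetric]) auto
  qed
  ultimately show ?case
    by (simp add: gauss_sum_mult[OF pos cop])
qed

text \<open>Both evaluations of the double sum carry the factor \<open>N\<close>, the number of
  units, which cancels.\<close>

lemma character_sum_eq_gauss_sum:
  assumes prim: "primitive_character k \<chi>" and real: "real_character \<chi>" and "odd k"
  shows "(\<Sum>n\<in>{0..<int k}. \<chi> n * unit_root k n) = gauss_sum k 1"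
proof -
  note char = dirichlet_character_if_primitive[OF prim]
  let ?R = "{0..<int k}"
  let ?G = "\<Sum>n\<in>?R. \<chi> n * unit_root k n"
  define N where "N = card (?R \<inter> {n. coprime n (int k)})"
  have N: "(\<Sum>n\<in>?R. \<chi> n * \<chi> n) = of_nat N"
  proof -
    have "\<chi> n * \<chi> n = (if coprime n (int k) then 1 else 0)" for n
      using real_character_square[OF char real, of n] character_not_coprime[OF char, of n] by simp
    then show ?thesis
      by (simp add: N_def sum.If_cases)
  qed
  \<comment> \<open>The reduced form of 1 also covers \<open>k = 1\<close>, where 1 itself lies
    outside the range.\<close>
  have "1 mod int k \<in> ?R \<inter> {n. coprime n (int k)}"
    using modulus_pos[OF char] by (simp add: coprime_mod_left_iff)
  then have "N > 0"
    unfolding N_def by (subst card_gt_0_iff) auto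
  have "(\<Sum>a\<in>?R. \<chi> a * gauss_sum k a) = (\<Sum>a\<in>?R. \<chi> a * \<chi> a * gauss_sum k 1)"
  proof (intro sum.cong refl)
    fix a
    show "\<chi> a * gauss_sum k a = \<chi> a * \<chi> a * gauss_sum k 1"
    proof (cases "coprime a (int k)")
      case True
      then show ?thesis
        by (subst gauss_sum_eq_character_mult[OF assms]) simp_all
    next
      case False
      then show ?thesis
        by (simp add: character_not_coprime[OF char])
    qed
  qed
  also have "\<dots> = of_nat N * gauss_sum k 1"
    by (simp add: N flip: sum_distrib_right)
  finally have "of_nat N * gauss_sum k 1 = (\<Sum>a\<in>?R. \<chi> a * gauss_sum k a)" ..
  also have "\<dots> = (\<Sum>n\<in>?R. \<Sum>a\<in>?R. \<chi> a * unit_root k (n\<^sup>2 * a))"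
    unfolding gauss_sum_def sum_distrib_left by (subst sum.swap) (simp add: mult.commute)
  also have "\<dots> = (\<Sum>n\<in>?R. \<chi> n * \<chi> n * ?G)"
    by (intro sum.cong refl) (simp only: character_sum_twisted[OF prim real] power2_eq_square character_mult[OF char])
  also have "\<dots> = of_nat N * ?G"
    by (simp add: N flip: sum_distrib_right)
  finally show ?thesis
    using \<open>N > 0\<close> by simp
qed

text \<open>Since \<open>\<chi> (- 1) = - 1\<close>, conjugation negates the Gauss sum. Comparison
  with \<open>gauss_sum_minus\<close> then excludes the class 1 modulo 4, as the sum is
  nonzero.\<close>

lemma gauss_sum_odd_character:
  assumes prim: "primitive_character k \<chi>" and real: "real_character \<chi>"
    and odd: "odd_character \<chi>" and "odd k"
  shows "k mod 4 = 3"
    and "Re (gauss_sum k 1) = 0" and "\<bar>Im (gauss_sum k 1)\<bar> = sqrt (real k)"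
proof -
  note char = dirichlet_character_if_primitive[OF prim]
  have k: "k > 0"
    using modulus_pos[OF char] .
  have norm: "(norm (gauss_sum k 1))\<^sup>2 = real k"
    using \<open>odd k\<close> by (rule norm_gauss_sum)
  then have nz: "gauss_sum k 1 \<noteq> 0"
    using k by auto
  have "\<chi> (- 1) = - 1"
    using odd character_1[OF char] by (simp add: odd_character_def)
  then have minus: "gauss_sum k (- 1) = - gauss_sum k 1"
    using gauss_sum_eq_character_mult[OF prim real \<open>odd k\<close>, of "- 1"] by simp
  moreover have "gauss_sum k (- 1) = (if k mod 4 = 1 then 1 else - 1) * gauss_sum k 1"
    using real_primitive_squarefree[OF prim real \<open>odd k\<close>] \<open>odd k\<close> by (intro gauss_sum_minus) auto
  ultimately have "k mod 4 \<noteq> 1"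
    using nz by auto
  with \<open>odd k\<close> show "k mod 4 = 3"
    by presburger
  have "cnj (gauss_sum k 1) = - gauss_sum k 1"
    using minus by (simp add: cnj_gauss_sum)
  then show Re: "Re (gauss_sum k 1) = 0"
    by (simp add: complex_eq_iff)
  then have "(Im (gauss_sum k 1))\<^sup>2 = real k"
    using norm by (simp add: cmod_power2)
  then show "\<bar>Im (gauss_sum k 1)\<bar> = sqrt (real k)"
    by (metis real_sqrt_abs)
qed

subsection \<open>The sign of the quadratic Gauss sum\<close>

text \<open>By concavity the graph of sine lies above its chord from 0 to \<open>a\<close>. The case
  \<open>a = pi / 2\<close> is Jordan's inequality; \<open>a = pi / 3\<close> is sharper at small
  angles.\<close>

lemma sin_mult_ge:
  fixes t a :: real
  assumes "0 \<le> t" "t \<le> 1" "0 \<le> a" "a \<le> pi"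
  shows "t * sin a \<le> sin (t * a)"
proof -
  have "concave_on {0..pi} sin"
  proof (rule f''_le0_imp_concave)
    show "(sin has_real_derivative cos x) (at x)" for x :: real
      by (rule DERIV_sin)
    show "(cos has_real_derivative - sin x) (at x)" for x :: real
      by (rule DERIV_cos)
  qed (auto intro: sin_ge_zero)
  from concave_onD[OF this, of t 0 a] show ?thesis
    using assms by simp
qed

lemma sin_half_pi_ge: "0 \<le> t \<Longrightarrow> t \<le> 1 \<Longrightarrow> t \<le> sin (pi / 2 * t)"
  using sin_mult_ge[of t "pi / 2"] by (simp add: mult.commute)

lemma cos_half_pi_ge: "0 \<le> t \<Longrightarrow> t \<le> 1 \<Longrightarrow> 1 - t \<le> cos (pi / 2 * t)"
  using sin_half_pi_ge[of "1 - t"] by (simp add: cos_sin_eq right_diff_distrib)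

text \<open>Summation by parts: the boundary terms contribute \<open>c 0\<close> and
  \<open>c n\<close>, and the total variation of the decreasing weights is
  \<open>c 0 - c n\<close>.\<close>

lemma norm_abel_sum_le:
  fixes F :: "nat \<Rightarrow> complex" and c :: "nat \<Rightarrow> real"
  assumes F: "\<And>i. norm (F i) \<le> 1" and c0: "0 \<le> c n"
    and dec: "\<And>i. i < n \<Longrightarrow> c (Suc i) \<le> c i"
  shows "norm (\<Sum>i\<le>n. of_real (c i) * (F (Suc i) - F i)) \<le> 2 * c 0"
proof -
  have mono: "c m \<le> c 0" if "m \<le> n" for m
    using that by (induction m) (auto intro: order_trans[OF dec])
  have "norm ((\<Sum>i\<le>m. of_real (c i) * (F (Suc i) - F i)) - of_real (c m) * F (Suc m)) \<le> 2 * c 0 - c m"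
    if "m \<le> n" for m
    using that
  proof (induction m)
    case 0
    have "c 0 \<ge> 0"
      using c0 mono[of n] by simp
    moreover from this have "c 0 * norm (F 0) \<le> c 0"
      using F[of 0] by (simp add: mult_left_le)
    ultimately show ?case
      by (simp add: algebra_simps norm_mult)
  next
    case (Suc m)
    let ?S = "(\<Sum>i\<le>m. of_real (c i) * (F (Suc i) - F i)) - of_real (c m) * F (Suc m)"
    have "c (Suc m) \<le> c m"
      using Suc.prems by (intro dec) simp
    then have "norm (of_real (c m - c (Suc m)) * F (Suc m)) \<le> c m - c (Suc m)"
      using F[of "Suc m"] by (simp add: norm_mult mult_left_le del: of_real_diff)
    moreover have "norm ?S \<le> 2 * c 0 - c m"
      using Suc by simp
    ultimately have "norm (?S + of_real (c m - c (Suc m)) * F (Suc m)) \<le> 2 * c 0 - c (Suc m)"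
      using norm_triangle_ineq[of ?S "of_real (c m - c (Suc m)) * F (Suc m)"] by linarith
    then show ?case
      by (simp add: algebra_simps)
  qed
  from this[of n]
  have "norm ((\<Sum>i\<le>n. of_real (c i) * (F (Suc i) - F i)) - of_real (c n) * F (Suc n)) \<le> 2 * c 0 - c n"
    by simp
  moreover have "norm (of_real (c n) * F (Suc n)) \<le> c n"
    using c0 F[of "Suc n"] by (simp add: norm_mult mult_left_le)
  ultimately show ?thesis
    using norm_triangle_ineq[of "(\<Sum>i\<le>n. of_real (c i) * (F (Suc i) - F i)) - of_real (c n) * F (Suc n)"
        "of_real (c n) * F (Suc n)"]
    by simp
qed

text \<open>
  The terms are \<open>c i * (F (i + 1) - F i)\<close> with \<open>c i = 1 / (2 sin (\<pi> (R + 2 i) / k))\<close> decreasing,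
  because \<open>(r + 1)\<^sup>2 - (r - 1)\<^sup>2 = 4 r\<close>.
\<close>

lemma norm_quadratic_exp_sum_le:
  fixes R k :: nat
  assumes "0 < R" and "2 * (R + 2 * n) \<le> k"
  shows "norm (\<Sum>i\<le>n. cis (pi * (real (R + 2 * i))\<^sup>2 / (2 * real k))) \<le> 1 / sin (pi * real R / real k)"
proof -
  have k: "k > 0"
    using assms by simp
  define s where "s i = sin (pi * real (R + 2 * i) / real k)" for i
  \<comment> \<open>The subtracted 1 is a constant rotation that makes the phases of
    \<open>F (Suc i)\<close> and \<open>F i\<close> differ from that of term \<open>i\<close> by
    exactly \<open>pi * r / k\<close> up and down; the factor \<open>- \<i>\<close> turns their
    difference into a real sine.\<close>
  define F where "F i = - \<i> * cis (pi * ((real (R + 2 * i) - 1)\<^sup>2 - 1) / (2 * real k))" for i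
  \<comment> \<open>All angles stay where sine is positive and increasing, so the weights
    decrease.\<close>
  have angle: "0 < pi * real (R + 2 * i) / real k \<and> pi * real (R + 2 * i) / real k \<le> pi / 2" if "i \<le> n" for i
  proof -
    have "2 * (R + 2 * i) \<le> k"
      using assms(2) that by presburger
    then have "real (2 * (R + 2 * i)) \<le> real k"
      by (simp only: of_nat_le_iff)
    then have "2 * real (R + 2 * i) \<le> real k"
      by simp
    then have "pi * (2 * real (R + 2 * i)) \<le> pi * real k"
      by (intro mult_left_mono) auto
    then have "pi * real (R + 2 * i) / real k \<le> pi / 2"
      using k by (simp add: field_simps)
    moreover have "0 < pi * real (R + 2 * i) / real k"
      using k assms(1) by (intro divide_pos_pos mult_pos_pos) auto
    ultimately show ?thesis
      by simp
  qed
  have s_pos: "s i > 0" if "i \<le> n" for i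
    unfolding s_def using angle[OF that] by (intro sin_gt_zero) linarith+
  have s_mono: "s i \<le> s (Suc i)" if "i < n" for i
    unfolding s_def using angle[of i] angle[of "Suc i"] that k
    by (intro sin_monotone_2pi_le) (auto simp: divide_right_mono)
  have step: "cis (pi * (real (R + 2 * i))\<^sup>2 / (2 * real k)) = of_real (1 / (2 * s i)) * (F (Suc i) - F i)"
    if "i \<le> n" for i
  proof -
    let ?r = "real (R + 2 * i)"
    let ?z = "cis (pi * ?r\<^sup>2 / (2 * real k))"
    let ?t = "pi * ?r / real k"
    have "pi * ((real (R + 2 * Suc i) - 1)\<^sup>2 - 1) / (2 * real k) = pi * ?r\<^sup>2 / (2 * real k) + ?t"
      using k by (simp add: field_simps power2_eq_square)
    then have "F (Suc i) = - \<i> * (?z * cis ?t)"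
      by (simp only: F_def cis_mult)
    moreover have "pi * ((?r - 1)\<^sup>2 - 1) / (2 * real k) = pi * ?r\<^sup>2 / (2 * real k) + - ?t"
      using k by (simp add: field_simps power2_eq_square)
    then have "F i = - \<i> * (?z * cis (- ?t))"
      by (simp only: F_def cis_mult)
    ultimately have "F (Suc i) - F i = ?z * (- \<i> * (cis ?t - cis (- ?t)))"
      by (simp add: algebra_simps)
    also have "- \<i> * (cis ?t - cis (- ?t)) = of_real (2 * s i)"
      by (simp add: complex_eq_iff s_def)
    finally show ?thesis
      using s_pos[OF that] by simp
  qed
  have "norm (\<Sum>i\<le>n. of_real (1 / (2 * s i)) * (F (Suc i) - F i)) \<le> 2 * (1 / (2 * s 0))"
  proof (rule norm_abel_sum_le)
    show "norm (F i) \<le> 1" for i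
      by (simp add: F_def norm_mult)
    show "0 \<le> 1 / (2 * s n)"
      using s_pos[of n] by simp
    show "1 / (2 * s (Suc i)) \<le> 1 / (2 * s i)" if "i < n" for i
      using s_mono[OF that] s_pos[of i] that by (intro divide_left_mono) auto
  qed
  also have "(\<Sum>i\<le>n. of_real (1 / (2 * s i)) * (F (Suc i) - F i)) =
      (\<Sum>i\<le>n. cis (pi * (real (R + 2 * i))\<^sup>2 / (2 * real k)))"
    by (intro sum.cong refl) (use step in auto)
  finally show ?thesis
    by (simp add: s_def)
qed

text \<open>Starting at \<open>R \<ge> q = sqrt k\<close> puts the first angle at
  \<open>pi / q\<close> or above. For \<open>q \<ge> 3\<close> the chord of sine up to
  \<open>pi / 3\<close> together with \<open>sqrt 3 \<ge> 5 / 3\<close> gives the constant 2/5; the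
  chord up to \<open>pi / 2\<close> would give only 1/2.\<close>

lemma norm_quadratic_exp_tail_le:
  fixes R h k :: nat
  assumes "9 \<le> k" and "real k \<le> (real R)\<^sup>2" and "2 * h \<le> k"
  shows "norm (\<Sum>r\<in>{r \<in> {R..h}. even r = even R}. cis (pi * (real r)\<^sup>2 / (2 * real k))) \<le> 2 / 5 * sqrt (real k)"
proof (cases "R \<le> h")
  case False
  then show ?thesis
    by simp
next
  case True
  define q where "q = sqrt (real k)"
  have q: "q \<ge> 3"
    unfolding q_def using assms(1) by (intro real_le_rsqrt) simp
  then have q3: "3 / q \<le> 1"
    by (subst divide_le_eq_1_pos) linarith+
  have qq: "q * q = real k"
    by (simp add: q_def)
  have R: "q \<le> real R"
    unfolding q_def using assms(2) by (intro real_le_lsqrt) auto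
  then have "R > 0"
    using q by auto
  define n where "n = (h - R) div 2"
  have le_h: "R + 2 * i \<le> h" if "i \<le> n" for i
  proof -
    have "2 * i \<le> 2 * n"
      using that by simp
    also have "2 * n \<le> h - R"
      by (simp add: n_def)
    finally show ?thesis
      using True by simp
  qed
  have "(\<Sum>r\<in>{r \<in> {R..h}. even r = even R}. cis (pi * (real r)\<^sup>2 / (2 * real k))) =
      (\<Sum>i\<le>n. cis (pi * (real (R + 2 * i))\<^sup>2 / (2 * real k)))"
  proof (rule sum.reindex_bij_witness[of _ "\<lambda>i. R + 2 * i" "\<lambda>r. (r - R) div 2"])
    fix r assume "r \<in> {r \<in> {R..h}. even r = even R}"
    then show "R + 2 * ((r - R) div 2) = r" "(r - R) div 2 \<in> {..n}"
      by (auto simp: n_def intro: div_le_mono diff_le_mono)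
    then show "cis (pi * (real (R + 2 * ((r - R) div 2)))\<^sup>2 / (2 * real k)) = cis (pi * (real r)\<^sup>2 / (2 * real k))"
      by simp
  next
    fix i assume "i \<in> {..n}"
    then show "R + 2 * i \<in> {r \<in> {R..h}. even r = even R}"
      using le_h[of i] by simp
  qed simp
  moreover have "2 * (R + 2 * n) \<le> k"
    using le_h[of n] assms(3) by simp
  ultimately have "norm (\<Sum>r\<in>{r \<in> {R..h}. even r = even R}. cis (pi * (real r)\<^sup>2 / (2 * real k))) \<le> 1 / sin (pi * real R / real k)"
    using norm_quadratic_exp_sum_le[OF \<open>R > 0\<close>, of n k] by simp
  also have "1 / sin (pi * real R / real k) \<le> 1 / (5 / (2 * q))"
  proof (rule divide_left_mono)
    have "5 / (2 * q) \<le> 3 / q * (sqrt 3 / 2)"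
    proof -
      have "5 / 3 \<le> sqrt 3"
        by (intro real_le_rsqrt) (simp add: power2_eq_square)
      then have "5 / (2 * q) \<le> 3 * sqrt 3 / (2 * q)"
        using q by (intro divide_right_mono) auto
      then show ?thesis
        by (simp add: mult.commute)
    qed
    also have "\<dots> \<le> sin (3 / q * (pi / 3))"
      using sin_mult_ge[of "3 / q" "pi / 3"] q3 q by (simp add: sin_60)
    also have "\<dots> \<le> sin (pi * real R / real k)"
    proof (rule sin_monotone_2pi_le)
      have "3 / q * (pi / 3) = pi * q / real k"
        using q by (simp flip: qq add: field_simps)
      also have "\<dots> \<le> pi * real R / real k"
        using R by (intro divide_right_mono mult_left_mono) auto
      finally show "3 / q * (pi / 3) \<le> pi * real R / real k" .
      have "pi * (2 * real R) \<le> pi * real k"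
        using True assms(3) by (intro mult_left_mono) auto
      then show "pi * real R / real k \<le> pi / 2"
        using assms(1) by (simp add: field_simps)
      have "0 \<le> 3 / q * (pi / 3)"
        using q by simp
      then show "- (pi / 2) \<le> 3 / q * (pi / 3)"
        using pi_ge_zero by linarith
    qed
    finally show "5 / (2 * q) \<le> sin (pi * real R / real k)" .
    moreover have "0 < 5 / (2 * q)"
      using q by simp
    ultimately show "0 < sin (pi * real R / real k) * (5 / (2 * q))"
      by (intro mult_pos_pos) (rule less_le_trans)
  qed simp
  also have "\<dots> = 2 / 5 * q"
    by simp
  finally show ?thesis
    unfolding q_def .
qed

text \<open>Totals the lower bounds for the initial terms: alternating squares add up to a
  triangular number with sign, and each odd \<open>r\<close> adds 1.\<close>

lemma sum_alternating_squares:
  fixes c :: real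
  assumes "c \<noteq> 0"
  shows "(\<Sum>r = 1..T. if even r then (real r)\<^sup>2 / c else 1 - (real r)\<^sup>2 / c) =
    (if even T then real T / 2 + real T * real (T + 1) / (2 * c)
     else real (T + 1) / 2 - real T * real (T + 1) / (2 * c))"
  using assms by (induction T) (auto simp: field_simps power2_eq_square)

text \<open>
  The terms up to \<open>T = \<lfloor>\<surd>k\<rfloor>\<close> are bounded below by Jordan's inequality,
  the remaining ones of either parity by partial summation.
\<close>

lemma sin_cos_squares_sum_gt:
  fixes h k :: nat
  assumes k: "k = 2 * h + 1" and "k = 7 \<or> k \<ge> 11"
  shows "(\<Sum>r = 1..h. if even r then sin (pi * (real r)\<^sup>2 / (2 * real k))
      else cos (pi * (real r)\<^sup>2 / (2 * real k))) > - (sqrt (real k) / 2)"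
    (is "sum ?t _ > _")
proof -
  have main: "?t r \<ge> (if even r then (real r)\<^sup>2 / real k else 1 - (real r)\<^sup>2 / real k)"
    if "r\<^sup>2 \<le> k" for r
  proof -
    have "real (r\<^sup>2) \<le> real k"
      using that by (simp only: of_nat_le_iff)
    then have "(real r)\<^sup>2 / real k \<le> 1"
      using k by simp
    then show ?thesis
      using sin_half_pi_ge[of "(real r)\<^sup>2 / real k"] cos_half_pi_ge[of "(real r)\<^sup>2 / real k"]
      by (simp add: field_simps)
  qed
  have k0: "real k \<noteq> 0"
    using k by simp
  have main_sum: "sum ?t {1..T} \<ge> (if even T then real T / 2 + real T * real (T + 1) / (2 * real k)
     else real (T + 1) / 2 - real T * real (T + 1) / (2 * real k))" if "T\<^sup>2 \<le> k" for T
    unfolding sum_alternating_squares[OF k0, symmetric]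
    using that by (intro sum_mono main) (auto intro: order_trans[OF power_mono])
  show ?thesis
  proof (cases "k = 7")
    \<comment> \<open>The tail estimate requires \<open>k \<ge> 9\<close>, so \<open>k = 7\<close>
      is done directly: two terms exceed 1 in total and the third is at least -1.\<close>
    case True
    then have "h = Suc 2"
      using k by simp
    then have "sum ?t {1..h} = sum ?t {1..2} + ?t (Suc 2)"
      by (simp only: sum.cl_ivl_Suc) simp
    moreover have "sum ?t {1..2} > 1"
      using main_sum[of 2] True by simp
    moreover have "?t (Suc 2) \<ge> - 1" "sqrt (real k) > 0"
      using True by simp_all
    ultimately show ?thesis
      by linarith
  next
    case False
    then have k11: "k \<ge> 11"
      using assms by simp
    define q where "q = sqrt (real k)"
    have qq: "q * q = real k"
      by (simp add: q_def)
    have q3: "q > 3"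
      unfolding q_def using k11 by (intro real_less_rsqrt) simp
    define T where "T = nat \<lfloor>q\<rfloor>"
    have T: "real T \<le> q" "q < real T + 1"
      using q3 by (auto simp: T_def)
    have "real T * real T \<le> q * q"
      using T q3 by (intro mult_mono) auto
    then have "real (T\<^sup>2) \<le> real k"
      by (simp add: qq power2_eq_square)
    then have T2: "T\<^sup>2 \<le> k"
      by (simp only: of_nat_le_iff)
    have "q * q < (real T + 1) * (real T + 1)"
      using T q3 by (intro mult_strict_mono) auto
    \<comment> \<open>The two tails, one for each parity, begin at \<open>Suc T\<close> and
      \<open>Suc (Suc T)\<close>.\<close>
    then have RT: "real k \<le> (real (Suc T))\<^sup>2" "real k \<le> (real (Suc (Suc T)))\<^sup>2"
      by (simp_all add: qq power2_eq_square algebra_simps)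
    have "T \<le> h"
    proof (rule ccontr)
      assume "\<not> T \<le> h"
      \<comment> \<open>\<open>(h + 1)\<^sup>2 \<le> 2 * h + 1\<close> would force
        \<open>h = 0\<close>.\<close>
      then have "(h + 1)\<^sup>2 \<le> T\<^sup>2"
        by (intro power_mono) auto
      then have "(h + 1)\<^sup>2 \<le> k"
        using T2 by (rule order_trans)
      then have "h * h \<le> 0"
        using k by (simp add: power2_eq_square)
      then show False
        using k k11 by simp
    qed
    let ?A = "\<lambda>R. {r \<in> {R..h}. even r = even R}"
    let ?Z = "\<lambda>R. \<Sum>r\<in>?A R. cis (pi * (real r)\<^sup>2 / (2 * real k))"
    have tail: "sum ?t (?A R) \<ge> - (2 / 5 * q)" if "real k \<le> (real R)\<^sup>2" for R
    proof -
      have "norm (?Z R) \<le> 2 / 5 * q"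
        unfolding q_def using that k k11 by (intro norm_quadratic_exp_tail_le) auto
      then have "\<bar>Re (?Z R)\<bar> \<le> 2 / 5 * q" "\<bar>Im (?Z R)\<bar> \<le> 2 / 5 * q"
        using abs_Re_le_cmod[of "?Z R"] abs_Im_le_cmod[of "?Z R"] by linarith+
      moreover have "sum ?t (?A R) = (if even R then Im (?Z R) else Re (?Z R))"
        by (auto intro!: sum.cong)
      ultimately show ?thesis
        by (simp split: if_splits)
    qed
    have "{1..h} = {1..T} \<union> ?A (Suc T) \<union> ?A (Suc (Suc T))"
      using \<open>T \<le> h\<close> by (intro Set.set_eqI) (simp, presburger)
    then have "sum ?t {1..h} = sum ?t ({1..T} \<union> ?A (Suc T) \<union> ?A (Suc (Suc T)))"
      by simp
    also have "\<dots> = sum ?t ({1..T} \<union> ?A (Suc T)) + sum ?t (?A (Suc (Suc T)))"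
      by (intro sum.union_disjoint) auto
    also have "sum ?t ({1..T} \<union> ?A (Suc T)) = sum ?t {1..T} + sum ?t (?A (Suc T))"
      by (intro sum.union_disjoint) auto
    finally have "sum ?t {1..h} \<ge> sum ?t {1..T} - 4 / 5 * q"
      using tail[OF RT(1)] tail[OF RT(2)] by linarith
    \<comment> \<open>The two tails cost at most \<open>4 / 5 * q\<close>, so
      \<open>3 / 10 * q\<close> is what a total above \<open>- q / 2\<close> needs.\<close>
    moreover have "sum ?t {1..T} > 3 / 10 * q"
    proof (cases "even T")
      case True
      have "(q - 1) * q \<le> real T * real (T + 1)"
        using T q3 by (intro mult_mono) auto
      then have "real T * real (T + 1) / (2 * real k) \<ge> (q - 1) * q / (2 * real k)"
        by (intro divide_right_mono) auto
      also have "(q - 1) * q / (2 * real k) = 1 / 2 - 1 / (2 * q)"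
        using q3 by (simp flip: qq add: field_simps)
      finally have "real T * real (T + 1) / (2 * real k) \<ge> 1 / 2 - 1 / (2 * q)" .
      moreover have "1 / (2 * q) \<le> 1 / 6"
        using q3 by (simp add: field_simps)
      ultimately show ?thesis
        using main_sum[OF T2] True T q3 unfolding if_P[OF True] by linarith
    next
      case False
      have "real T * real (T + 1) \<le> q * real (T + 1)"
        using T by (intro mult_right_mono) auto
      then have "real T * real (T + 1) / (2 * real k) \<le> q * real (T + 1) / (2 * real k)"
        by (intro divide_right_mono) auto
      also have "\<dots> = real (T + 1) / (2 * q)"
        using q3 by (simp flip: qq add: field_simps)
      finally have "sum ?t {1..T} \<ge> real (T + 1) / 2 - real (T + 1) / (2 * q)"
        using main_sum[OF T2] False by simp
      also have "real (T + 1) / 2 - real (T + 1) / (2 * q) = real (T + 1) * ((q - 1) / (2 * q))"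
        using q3 by (simp add: field_simps)
      finally have le: "sum ?t {1..T} \<ge> real (T + 1) * ((q - 1) / (2 * q))" .
      have "(q - 1) / 2 = q * ((q - 1) / (2 * q))"
        using q3 by simp
      also have "\<dots> \<le> real (T + 1) * ((q - 1) / (2 * q))"
        using T q3 by (intro mult_right_mono) auto
      also note le
      finally have "(q - 1) / 2 \<le> sum ?t {1..T}" .
      moreover have "3 / 10 * q < (q - 1) / 2"
        using q3 by simp
      ultimately show ?thesis
        by (rule less_le_trans[rotated])
    qed
    ultimately show ?thesis
      unfolding q_def by linarith
  qed
qed

text \<open>
  Substituting \<open>n = (k + 1) / 2 * r\<close> with \<open>\<bar>r\<bar> < k / 2\<close> folds the two stationary points of the phase
  \<open>n\<^sup>2 / k\<close>, at \<open>0\<close> and at \<open>k / 2\<close>, into the single point \<open>r = 0\<close>.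
\<close>

lemma gauss_sum_folded:
  assumes k: "k = 2 * h + 1" and k4: "k mod 4 = 3"
  shows "gauss_sum k 1 = 1 + 2 * (\<Sum>r = 1..h. (if even r then 1 else \<i>) * cis (pi * (real r)\<^sup>2 / (2 * real k)))"
proof -
  \<comment> \<open>The inverse of 2 modulo \<open>k\<close>, since
    \<open>2 * c = k + 1\<close>.\<close>
  define c where "c = int h + 1"
  have "coprime c (int k)"
  proof (rule coprimeI)
    fix d assume "d dvd c" "d dvd int k"
    then have "d dvd 2 * c - int k"
      by simp
    then show "is_unit d"
      by (simp add: c_def k)
  qed
  then have "gauss_sum k 1 = gauss_sum k (c\<^sup>2)"
    using gauss_sum_mult_square[of k c 1] k by simp
  also have "\<dots> = 1 + 2 * (\<Sum>n\<in>{1..int h}. unit_root k (c\<^sup>2 * n\<^sup>2))"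
    by (rule gauss_sum_half[OF k])
  also have "(\<Sum>n\<in>{1..int h}. unit_root k (c\<^sup>2 * n\<^sup>2)) = (\<Sum>r = 1..h. unit_root k (c\<^sup>2 * (int r)\<^sup>2))"
    by (rule sum.reindex_bij_witness[of _ int nat]) auto
  also have "\<dots> = (\<Sum>r = 1..h. (if even r then 1 else \<i>) * cis (pi * (real r)\<^sup>2 / (2 * real k)))"
  proof (rule sum.cong[OF refl])
    fix r
    \<comment> \<open>From \<open>4 * c\<^sup>2 = k * (k + 2) + 1\<close> a fourth root of unity
      splits off; it depends only on the parity of \<open>r\<close>, because \<open>k + 2\<close> is
      1 modulo 4.\<close>
    have "2 * pi * of_int (c\<^sup>2 * (int r)\<^sup>2) / real k =
        2 * pi * of_int ((int r)\<^sup>2 * (int k + 2)) / real 4 + pi * (real r)\<^sup>2 / (2 * real k)"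
      by (simp add: c_def k field_simps power2_eq_square)
    then have "unit_root k (c\<^sup>2 * (int r)\<^sup>2) =
        unit_root 4 ((int r)\<^sup>2 * (int k + 2)) * cis (pi * (real r)\<^sup>2 / (2 * real k))"
      unfolding unit_root_def by (simp only: cis_mult)
    moreover have "unit_root 4 ((int r)\<^sup>2 * (int k + 2)) = (if even r then 1 else \<i>)"
    proof (cases "even r")
      case True
      then have "int 4 dvd (int r)\<^sup>2 * (int k + 2)"
        by (auto elim!: evenE simp: power2_eq_square)
      then show ?thesis
        using True unit_root_eq_1_iff[of 4] by simp
    next
      case False
      then obtain s where s: "r = 2 * s + 1"
        by (rule oddE)
      have "k = 4 * (k div 4) + 3"
        using k4 div_mult_mod_eq[of k 4] by simp
      then obtain t where t: "k = 4 * t + 3"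
        by blast
      have "(int r)\<^sup>2 * (int k + 2) - 1 = 4 * ((int s * int s + int s) * (4 * int t + 5) + int t + 1)"
        by (simp add: s t power2_eq_square algebra_simps)
      then have "[(int r)\<^sup>2 * (int k + 2) = 1] (mod int 4)"
        by (simp add: cong_iff_dvd_diff)
      then have "unit_root 4 ((int r)\<^sup>2 * (int k + 2)) = unit_root 4 1"
        by (intro unit_root_cong) simp_all
      also have "\<dots> = \<i>"
        by (simp add: unit_root_def cis_pi_half)
      finally show ?thesis
        using False by simp
    qed
    ultimately show "unit_root k (c\<^sup>2 * (int r)\<^sup>2) =
        (if even r then 1 else \<i>) * cis (pi * (real r)\<^sup>2 / (2 * real k))"
      by simp
  qed
  finally show ?thesis .
qed

text \<open>The factor \<open>\<i>\<close> at odd \<open>r\<close> turns sine into cosine in the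
  imaginary part, and the class 3 modulo 4 leaves only \<open>k = 7\<close> or
  \<open>k \<ge> 11\<close>.\<close>

lemma Im_gauss_sum_gt:
  assumes "k mod 4 = 3" and "k \<ge> 7"
  shows "Im (gauss_sum k 1) > - sqrt (real k)"
proof -
  have "odd k"
    using assms(1) by presburger
  then obtain h where h: "k = 2 * h + 1"
    by (rule oddE)
  have "k = 7 \<or> k \<ge> 11"
    using assms by presburger
  moreover have "Im (gauss_sum k 1) = 2 * (\<Sum>r = 1..h. if even r then sin (pi * (real r)\<^sup>2 / (2 * real k))
      else cos (pi * (real r)\<^sup>2 / (2 * real k)))"
  proof -
    have "Im (\<Sum>r = 1..h. (if even r then 1 else \<i>) * cis (pi * (real r)\<^sup>2 / (2 * real k))) =
       (\<Sum>r = 1..h. if even r then sin (pi * (real r)\<^sup>2 / (2 * real k)) else cos (pi * (real r)\<^sup>2 / (2 * real k)))"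
      unfolding Im_sum by (intro sum.cong) auto
    then show ?thesis
      unfolding gauss_sum_folded[OF h assms(1)] by simp
  qed
  ultimately show ?thesis
    using sin_cos_squares_sum_gt[OF h] by linarith
qed

theorem theorem4p11:
  fixes k :: nat and \<chi> :: "int \<Rightarrow> complex"
  assumes "k \<ge> 7" and "odd k"
    and "dirichlet_character k \<chi>"
    and "\<chi> \<noteq> principal_character k"
    and "real_character \<chi>"
    and "primitive_character k \<chi>"
    and "odd_character \<chi>"
  shows "(\<Sum>j = 1..k - 1. \<chi> (int j) * complex_of_real
            ((sin (pi * real j / real k))\<^sup>2 * cot (pi * real j / real k)))
         = complex_of_real (1 / 2 * sqrt (real k))"
proof -
  let ?G = "\<Sum>n\<in>{0..<int k}. \<chi> n * unit_root k n"
  have G: "?G = gauss_sum k 1"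
    using assms by (intro character_sum_eq_gauss_sum)
  have "k mod 4 = 3" and abs: "\<bar>Im (gauss_sum k 1)\<bar> = sqrt (real k)"
    using gauss_sum_odd_character[OF assms(6,5,7,2)] by blast+
  then have "Im (gauss_sum k 1) > - sqrt (real k)"
    using assms(1) by (intro Im_gauss_sum_gt)
  with abs have Im: "Im ?G = sqrt (real k)"
    unfolding G by linarith
  have real: "\<chi> n = of_real (Re (\<chi> n))" for n
    using assms(5) by (simp add: real_character_def)
  have sin_cot: "(sin x)\<^sup>2 * cot x = 1 / 2 * sin (2 * x)" for x :: real
    by (simp add: cot_def power2_eq_square sin_double)
  have "(\<Sum>j = 1..k - 1. \<chi> (int j) * complex_of_real
            ((sin (pi * real j / real k))\<^sup>2 * cot (pi * real j / real k))) =
      (\<Sum>j = 1..k - 1. of_real (Re (\<chi> (int j)) * (1 / 2 * sin (2 * (pi * real j / real k)))))"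
    by (intro sum.cong refl) (subst real, simp only: sin_cot of_real_mult)
  also have "\<dots> = of_real (1 / 2 * (\<Sum>j = 1..k - 1. Re (\<chi> (int j)) * sin (2 * pi * real j / real k)))"
    by (simp add: sum_distrib_left mult_ac)
  also have "(\<Sum>j = 1..k - 1. Re (\<chi> (int j)) * sin (2 * pi * real j / real k)) =
      (\<Sum>n\<in>{1..<int k}. Re (\<chi> n) * sin (2 * pi * of_int n / real k))"
    by (rule sum.reindex_bij_witness[of _ nat int]) auto
  \<comment> \<open>The term at 0 vanishes with the sine, so it can be added to complete the residue
    system.\<close>
  also have "\<dots> = (\<Sum>n\<in>insert 0 {1..<int k}. Re (\<chi> n) * sin (2 * pi * of_int n / real k))"
    by simp
  also have "insert 0 {1..<int k} = {0..<int k}"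
    using assms(1) by auto
  also have "(\<Sum>n\<in>{0..<int k}. Re (\<chi> n) * sin (2 * pi * of_int n / real k)) = Im ?G"
    unfolding Im_sum
  proof (rule sum.cong[OF refl])
    fix n
    have "Im (\<chi> n) = 0"
      using real[of n] by (metis Im_complex_of_real)
    then show "Re (\<chi> n) * sin (2 * pi * of_int n / real k) = Im (\<chi> n * unit_root k n)"
      by (simp add: unit_root_def)
  qed
  finally show ?thesis
    unfolding Im .
qed

end
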